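(* Let $Q$ be a quiver that has a rank function, and let $R$ be a proper subquiver of $Q$. Then $\operatorname{DE}(R)$ is a face of $\operatorname{DE}(Q)$ if and only if each connected component of $R$ is a full subquiver of $Q$ and $Q/R$ is acyclic.
   Context: A quiver is a pair $Q=(Q_0,Q_1)$ with $Q_0$ a finite set and $Q_1\subset (Q_0\times Q_0)\setminus\{(v,v)\mid v\in Q_0\}$. For $v\in Q_0$ let $\kappa_{\{v\}}\in\mathbb{R}^{Q_0}$ be the indicator function of $v$, and $\varepsilon_{(v,w)}=\kappa_{\{v\}}-\kappa_{\{w\}}$; $\operatorname{DE}(Q)=\operatorname{conv}\{\varepsilon_{(v,w)}\mid (v,w)\in Q_1\}\subset\mathbb{R}^{Q_0}$, and for a subquiver $R$, $\operatorname{DE}(R)=\operatorname{conv}\{\varepsilon_{(v,w)}\mid(v,w)\in R_1\}$ viewed in $\mathbb{R}^{Q_0}$. A subquiver $R$ has $R_0\subset Q_0$, $R_1\subset Q_1$; it is proper if $R_1\subsetneq Q_1$ and full if $R_1=\{(v,w)\in Q_1\mid v,w\in R_0\}$. Connected components are defined via undirected walks (sequences of vertices with consecutive ones joined by an edge in either direction). A rank function of $Q$ is $\rho:Q_0\to\mathbb{R}$ with $\rho(v)+1=\rho(w)$ for each $(v,w)\in Q_1$. A quiver is acyclic if it has no directed cycle ($v_0,\dots,v_n$, $n>1$, $v_n=v_0$, $(v_t,v_{t+1})$ edges). Contraction: when each component of $R$ is full in $Q$, let $v\sim w$ on $Q_0$ iff $v,w$ are joined by an undirected walk in $R$; $Q/R$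 has vertex set $Q_0/\sim$ and edges $\{([v],[w])\mid (v,w)\in Q_1\setminus R_1\}$. *)

theory Defs
  imports "HOL-Analysis.Analysis"
begin

record 'v quiver =
  verts :: "'v set"
  arcs :: "('v \<times> 'v) set"

definition is_quiver :: "'v quiver \<Rightarrow> bool" where
  "is_quiver Q \<longleftrightarrow> finite (verts Q) \<and> arcs Q \<subseteq> verts Q \<times> verts Q - Id"

definition subquiver :: "'v quiver \<Rightarrow> 'v quiver \<Rightarrow> bool" where
  "subquiver R Q \<longleftrightarrow> is_quiver R \<and> verts R \<subseteq> verts Q \<and> arcs R \<subseteq> arcs Q"

text \<open>Properness only concerns the arcs; the vertex sets may coincide.\<close>

definition proper_subquiver :: "'v quiver \<Rightarrow> 'v quiver \<Rightarrow> bool" where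
  "proper_subquiver R Q \<longleftrightarrow> subquiver R Q \<and> arcs R \<subset> arcs Q"

definition full_subquiver :: "'v quiver \<Rightarrow> 'v quiver \<Rightarrow> bool" where
  "full_subquiver R Q \<longleftrightarrow>
     subquiver R Q \<and> arcs R = {(v, w) \<in> arcs Q. v \<in> verts R \<and> w \<in> verts R}"

definition is_rank_function :: "'v quiver \<Rightarrow> ('v \<Rightarrow> real) \<Rightarrow> bool" where
  "is_rank_function Q \<rho> \<longleftrightarrow> (\<forall>(v, w) \<in> arcs Q. \<rho> v + 1 = \<rho> w)"

text \<open>
  Walks are given by their vertex sequences; a walk with a single vertex is allowed.
\<close>

definition undirected_walk :: "'v quiver \<Rightarrow> 'v list \<Rightarrow> bool" where
  "undirected_walk Q vs \<longleftrightarrow> vs \<noteq> [] \<and> set vs \<subseteq> verts Q \<and>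
     successively (\<lambda>v w. (v, w) \<in> arcs Q \<or> (w, v) \<in> arcs Q) vs"

definition joined :: "'v quiver \<Rightarrow> ('v \<times> 'v) set" where
  "joined Q = {(v, w). \<exists>vs. undirected_walk Q vs \<and> hd vs = v \<and> last vs = w}"

definition connected_components :: "'v quiver \<Rightarrow> 'v quiver set" where
  "connected_components Q =
     (\<lambda>C. \<lparr>verts = C, arcs = arcs Q \<inter> C \<times> C\<rparr>) ` (verts Q // joined Q)"

text \<open>The list is \<open>v\<^sub>0, \<dots>, v\<^sub>n\<close>, so its length is \<open>n + 1\<close>.\<close>

definition directed_cycle :: "'v quiver \<Rightarrow> 'v list \<Rightarrow> bool" where
  "directed_cycle Q vs \<longleftrightarrow> length vs - 1 > 1 \<and> set vs \<subseteq> verts Q \<and>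
     last vs = hd vs \<and> successively (\<lambda>v w. (v, w) \<in> arcs Q) vs"

definition acyclic_quiver :: "'v quiver \<Rightarrow> bool" where
  "acyclic_quiver Q \<longleftrightarrow> (\<nexists>vs. directed_cycle Q vs)"

text \<open>
  Vertices of \<open>Q\<close> outside \<open>R\<close> are related only to themselves, which makes the relation an
  equivalence on the vertices of \<open>Q\<close>.
\<close>

definition contraction_rel :: "'v quiver \<Rightarrow> 'v quiver \<Rightarrow> ('v \<times> 'v) set" where
  "contraction_rel Q R = Id_on (verts Q) \<union> joined R"

text \<open>
  The contraction of \<open>R\<close> in \<open>Q\<close> is meaningful, i.e. again a loopless quiver, when every
  connected component of \<open>R\<close> is full in \<open>Q\<close>.
\<close>

definition contraction :: "'v quiver \<Rightarrow> 'v quiver \<Rightarrow> 'v set quiver" where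
  "contraction Q R =
     \<lparr>verts = verts Q // contraction_rel Q R,
      arcs = {(contraction_rel Q R `` {v}, contraction_rel Q R `` {w}) | v w.
               (v, w) \<in> arcs Q - arcs R}\<rparr>"

text \<open>
  All polytopes live in \<open>\<real>\<^sup>V\<close> for the finite type \<open>V\<close> of potential vertices. It contains
  \<open>\<real>\<^bsup>Q\<^sub>0\<^esup>\<close> as the coordinate subspace of vectors supported on \<open>Q\<^sub>0\<close>, and
  \<open>axis v 1\<close> is the indicator function of \<open>v\<close>.
\<close>

definition edge_vector :: "'v \<times> 'v \<Rightarrow> real ^ 'v::finite" where
  "edge_vector e = axis (fst e) 1 - axis (snd e) 1"

definition DE :: "'v::finite quiver \<Rightarrow> (real ^ 'v) set" where
  "DE Q = convex hull (edge_vector ` arcs Q)"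

end

theory Submission
  imports Defs
begin

text \<open>
  Both sides are equivalent to the existence of a potential: a function \<open>\<phi>\<close> on the vertices
  that is constant along the arcs of \<open>R\<close> and strictly increasing along the other arcs of \<open>Q\<close>.
  Regarded as a linear functional, \<open>\<phi>\<close> vanishes on the edge vectors of \<open>R\<close> and is negative on
  the remaining ones, hence exposes \<open>DE R\<close>. Conversely, faces of polytopes are exposed by a
  functional \<open>a\<close> with some value \<open>b\<close>, and since a rank function \<open>\<rho>\<close> takes the value \<open>- 1\<close> on all
  edge vectors, \<open>a + b \<rho>\<close> is a potential. On the combinatorial side, a potential is a strictly
  monotone function on the contraction, and such a function exists iff the contraction has
  neither loops nor directed cycles.
\<close>

definition potential :: "'v quiver \<Rightarrow> 'v quiver \<Rightarrow> ('v \<Rightarrow> real) \<Rightarrow> bool" where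
  "potential Q R \<phi> \<longleftrightarrow>
     (\<forall>(v, w) \<in> arcs R. \<phi> v = \<phi> w) \<and> (\<forall>(v, w) \<in> arcs Q - arcs R. \<phi> v < \<phi> w)"

lemma potential_eq: "potential Q R \<phi> \<Longrightarrow> (v, w) \<in> arcs R \<Longrightarrow> \<phi> v = \<phi> w"
  by (auto simp: potential_def)

lemma potential_less:
  "potential Q R \<phi> \<Longrightarrow> (v, w) \<in> arcs Q \<Longrightarrow> (v, w) \<notin> arcs R \<Longrightarrow> \<phi> v < \<phi> w"
  by (auto simp: potential_def)

subsection \<open>Walks\<close>

text \<open>Lets the walks of the definitions, given as vertex lists, be handled by induction on
  closures; the one-vertex list is the reflexive case.\<close>

lemma rtrancl_iff_successively:
  "(v, w) \<in> r\<^sup>* \<longleftrightarrow>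
     (\<exists>vs. vs \<noteq> [] \<and> successively (\<lambda>a b. (a, b) \<in> r) vs \<and> hd vs = v \<and> last vs = w)"
proof
  assume "(v, w) \<in> r\<^sup>*"
  then show "\<exists>vs. vs \<noteq> [] \<and> successively (\<lambda>a b. (a, b) \<in> r) vs \<and> hd vs = v \<and> last vs = w"
  proof (induction rule: converse_rtrancl_induct)
    case base
    show ?case by (intro exI[of _ "[w]"]) simp
  next
    case (step y z)
    then obtain vs where "vs \<noteq> []" "successively (\<lambda>a b. (a, b) \<in> r) vs" "hd vs = z" "last vs = w"
      by blast
    with step(1) show ?case by (intro exI[of _ "y # vs"]) (simp add: successively_Cons)
  qed
next
  have "vs \<noteq> [] \<Longrightarrow> successively (\<lambda>a b. (a, b) \<in> r) vs \<Longrightarrow> (hd vs, last vs) \<in> r\<^sup>*" for vs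
    by (induction vs) (auto simp: successively_Cons intro: converse_rtrancl_into_rtrancl)
  then show "\<exists>vs. vs \<noteq> [] \<and> successively (\<lambda>a b. (a, b) \<in> r) vs \<and> hd vs = v \<and> last vs = w
      \<Longrightarrow> (v, w) \<in> r\<^sup>*"
    by blast
qed

lemma successively_set_subset:
  assumes "successively (\<lambda>a b. (a, b) \<in> r) vs" "vs \<noteq> []" "hd vs \<in> V" "r \<subseteq> V \<times> V"
  shows "set vs \<subseteq> V"
  using assms
proof (induction vs)
  case (Cons a vs)
  then show ?case by (cases vs) auto
qed simp

text \<open>The start needs its own condition because the closure is reflexive on the whole type;
  all later vertices are ends of arcs and hence lie in \<open>verts R\<close>.\<close>

lemma joined_eq_rtrancl:
  assumes "is_quiver R"
  shows "joined R = {(v, w). v \<in> verts R \<and> (v, w) \<in> (arcs R \<union> (arcs R)\<inverse>)\<^sup>*}"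
proof -
  let ?r = "arcs R \<union> (arcs R)\<inverse>"
  have sub: "?r \<subseteq> verts R \<times> verts R"
    using assms by (auto simp: is_quiver_def)
  have walk: "undirected_walk R vs \<longleftrightarrow>
      vs \<noteq> [] \<and> hd vs \<in> verts R \<and> successively (\<lambda>a b. (a, b) \<in> ?r) vs" for vs
    using successively_set_subset[OF _ _ _ sub, of vs] hd_in_set[of vs]
    by (auto simp: undirected_walk_def)
  show ?thesis
    unfolding joined_def rtrancl_iff_successively walk by blast
qed

lemma equiv_joined:
  assumes "is_quiver R"
  shows "equiv (verts R) (joined R)"
proof -
  let ?r = "arcs R \<union> (arcs R)\<inverse>"
  have sub: "?r \<subseteq> verts R \<times> verts R"
    using assms by (auto simp: is_quiver_def)
  have "w \<in> verts R" if "(v, w) \<in> ?r\<^sup>*" "v \<in> verts R" for v w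
    using that sub by (cases rule: rtranclE) auto
  moreover have "sym (?r\<^sup>*)"
    by (intro sym_rtrancl) (auto simp: sym_def)
  ultimately show ?thesis
    unfolding joined_eq_rtrancl[OF assms]
    by (intro equivI) (auto simp: refl_on_def sym_def trans_def)
qed

text \<open>\<open>joined R\<close> is an equivalence only on \<open>verts R\<close>; the diagonal
  adds the remaining vertices as singleton classes, and composing with it changes nothing.\<close>

lemma equiv_contraction_rel:
  assumes "subquiver R Q"
  shows "equiv (verts Q) (contraction_rel Q R)"
proof -
  have "equiv (verts R) (joined R)" "verts R \<subseteq> verts Q"
    using assms equiv_joined by (auto simp: subquiver_def)
  then show ?thesis
    unfolding contraction_rel_def
    by (intro equivI) (auto simp: equiv_def refl_on_def dest: symD intro!: symI transI dest: transD)
qed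

lemma directed_cycle_if_not_acyclic:
  assumes "\<not> acyclic (arcs Q)" "arcs Q \<subseteq> verts Q \<times> verts Q - Id"
  shows "\<exists>vs. directed_cycle Q vs"
proof -
  obtain x where "(x, x) \<in> (arcs Q)\<^sup>+"
    using assms(1) by (auto simp: acyclic_def)
  then obtain y where y: "(x, y) \<in> arcs Q" "(y, x) \<in> (arcs Q)\<^sup>*"
    by (meson tranclD)
  then obtain vs where vs: "vs \<noteq> []" "successively (\<lambda>a b. (a, b) \<in> arcs Q) vs"
      "hd vs = y" "last vs = x"
    by (auto simp: rtrancl_iff_successively)
  have "x \<in> verts Q" "y \<in> verts Q" "y \<noteq> x"
    using y(1) assms(2) by auto
  moreover have "set vs \<subseteq> verts Q"
    using successively_set_subset[OF vs(2,1)] vs(3) assms(2) \<open>y \<in> verts Q\<close> by blast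
  \<comment> \<open>Without loops, \<open>vs\<close> runs between distinct vertices; prepending
    \<open>x\<close> then gives at least three entries, as the condition \<open>n > 1\<close> on
    cycles asks.\<close>
  moreover have "length vs > 1"
    using vs \<open>y \<noteq> x\<close> by (cases vs) auto
  ultimately have "directed_cycle Q (x # vs)"
    using vs y(1) by (auto simp: directed_cycle_def successively_Cons)
  then show ?thesis ..
qed

text \<open>Count the predecessors in the transitive closure. The count grows strictly along
  \<open>(x, y)\<close>, since \<open>x\<close> precedes \<open>y\<close> but, by acyclicity, not
  itself.\<close>

lemma finite_acyclic_strict_mono:
  assumes "finite r" "acyclic r"
  shows "\<exists>f :: 'a \<Rightarrow> nat. \<forall>(x, y) \<in> r. f x < f y"
proof (intro exI ballI, clarify)
  fix x y assume xy: "(x, y) \<in> r"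
  have "{z. (z, x) \<in> r\<^sup>+} \<subset> {z. (z, y) \<in> r\<^sup>+}"
    using xy assms(2) by (auto simp: acyclic_def dest: trancl_into_trancl)
  moreover have "finite {z. (z, y) \<in> r\<^sup>+}"
    by (rule finite_subset[of _ "fst ` (r\<^sup>+)"]) (use assms(1) in \<open>force+\<close>)
  ultimately show "card {z. (z, x) \<in> r\<^sup>+} < card {z. (z, y) \<in> r\<^sup>+}"
    by (rule psubset_card_mono[rotated])
qed

subsection \<open>Potentials and contractions\<close>

lemma potential_joined:
  assumes "potential Q R \<phi>" "is_quiver R" "(v, w) \<in> joined R"
  shows "\<phi> v = \<phi> w"
proof -
  have "(v, w) \<in> (arcs R \<union> (arcs R)\<inverse>)\<^sup>*"
    using assms(2,3) by (simp add: joined_eq_rtrancl)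
  then show ?thesis
    using assms(1) by (induction rule: rtrancl_induct) (auto simp: potential_def)
qed

text \<open>A potential is constant on each component but increases along arcs outside
  \<open>R\<close>, so no such arc has both ends in one component.\<close>

lemma potential_imp_full_components:
  assumes "potential Q R \<phi>" "subquiver R Q" "C \<in> connected_components R"
  shows "full_subquiver C Q"
proof -
  have R: "is_quiver R" and RQ: "verts R \<subseteq> verts Q" "arcs R \<subseteq> arcs Q"
    using assms(2) by (auto simp: subquiver_def)
  obtain v where v: "v \<in> verts R"
    and C: "C = \<lparr>verts = joined R `` {v}, arcs = arcs R \<inter> (joined R `` {v}) \<times> (joined R `` {v})\<rparr>"
    using assms(3) by (auto simp: connected_components_def quotient_def)
  have sub: "joined R `` {v} \<subseteq> verts R"
    using equiv_joined[OF R] equiv_type by fastforce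
  have "(x, y) \<in> arcs R"
    if "(x, y) \<in> arcs Q" "x \<in> joined R `` {v}" "y \<in> joined R `` {v}" for x y
  proof -
    have "\<phi> x = \<phi> y"
      using that potential_joined[OF assms(1) R] by (metis Image_singleton_iff)
    then show ?thesis
      using that(1) potential_less[OF assms(1)] by force
  qed
  then have "arcs C = {(x, y) \<in> arcs Q. x \<in> verts C \<and> y \<in> verts C}"
    using RQ unfolding C by auto
  moreover have "is_quiver C"
    using R sub finite_subset[OF sub] unfolding C is_quiver_def by auto
  ultimately show ?thesis
    using RQ sub unfolding full_subquiver_def subquiver_def C by auto
qed

lemma potential_imp_acyclic_contraction:
  assumes "potential Q R \<phi>" "is_quiver Q" "subquiver R Q"
  shows "acyclic_quiver (contraction Q R)"
  unfolding acyclic_quiver_def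
proof
  assume "\<exists>vs. directed_cycle (contraction Q R) vs"
  then obtain vs where vs: "length vs > 2" "last vs = hd vs"
      "successively (\<lambda>X Y. (X, Y) \<in> arcs (contraction Q R)) vs"
    unfolding directed_cycle_def by (metis less_diff_conv one_add_one)
  have R: "is_quiver R"
    using assms(3) by (simp add: subquiver_def)
  \<comment> \<open>The choice of representative is harmless: \<phi> is constant on each class and
    so descends to the contraction.\<close>
  define \<psi> where "\<psi> X = \<phi> (SOME v. v \<in> X)" for X
  have \<psi>: "\<psi> (contraction_rel Q R `` {v}) = \<phi> v" if "v \<in> verts Q" for v
  proof -
    have "v \<in> contraction_rel Q R `` {v}"
      using that by (auto simp: contraction_rel_def)
    then have "(SOME w. w \<in> contraction_rel Q R `` {v}) \<in> contraction_rel Q R `` {v}"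
      by (rule someI)
    then show ?thesis
      using potential_joined[OF assms(1) R] unfolding \<psi>_def contraction_rel_def by fastforce
  qed
  have "\<psi> X < \<psi> Y" if XY: "(X, Y) \<in> arcs (contraction Q R)" for X Y
  proof -
    obtain v w where "X = contraction_rel Q R `` {v}" "Y = contraction_rel Q R `` {w}"
        "(v, w) \<in> arcs Q - arcs R"
      using XY by (auto simp: contraction_def)
    moreover from this have "v \<in> verts Q" "w \<in> verts Q"
      using assms(2) by (auto simp: is_quiver_def)
    ultimately show ?thesis
      using potential_less[OF assms(1)] \<psi> by auto
  qed
  then have "successively (\<lambda>X Y. \<psi> X < \<psi> Y) vs"
    using vs(3) by (rule successively_mono[rotated])
  then have "sorted_wrt (\<lambda>X Y. \<psi> X < \<psi> Y) vs"
    by (simp add: successively_conv_sorted_wrt transp_def)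
  \<comment> \<open>The last entry lies in the tail of \<open>vs\<close>, so its value exceeds that
    of the first entry, with which it coincides.\<close>
  with vs(1,2) show False
    by (cases vs) (auto split: if_splits dest: last_in_set)
qed

lemma exists_potential:
  assumes "is_quiver Q" "subquiver R Q"
    and full: "\<forall>C \<in> connected_components R. full_subquiver C Q"
    and acyc: "acyclic_quiver (contraction Q R)"
  shows "\<exists>\<phi>. potential Q R \<phi>"
proof -
  let ?c = "contraction_rel Q R" and ?K = "contraction Q R"
  have R: "is_quiver R"
    using assms(2) by (simp add: subquiver_def)
  note eqR = equiv_joined[OF R] and eqc = equiv_contraction_rel[OF assms(2)]
  have in_verts: "v \<in> verts Q" "w \<in> verts Q" "v \<noteq> w" if "(v, w) \<in> arcs Q" for v w
    using that assms(1) by (auto simp: is_quiver_def)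
  \<comment> \<open>Fullness excludes loops in the contraction: an arc inside one class has distinct
    ends, so the class is a component of \<open>R\<close>, which then contains the arc.\<close>
  have "?c `` {v} \<noteq> ?c `` {w}" if vw: "(v, w) \<in> arcs Q - arcs R" for v w
  proof
    assume "?c `` {v} = ?c `` {w}"
    then have "(v, w) \<in> ?c"
      using eq_equiv_class[OF _ eqc] in_verts vw by blast
    then have vw': "(v, w) \<in> joined R" "v \<in> verts R"
      using in_verts(3)[of v w] vw equiv_type[OF eqR] by (auto simp: contraction_rel_def)
    let ?C = "\<lparr>verts = joined R `` {v}, arcs = arcs R \<inter> (joined R `` {v}) \<times> (joined R `` {v})\<rparr>"
    have "?C \<in> connected_components R"
      using vw'(2) by (auto simp: connected_components_def intro: quotientI)
    then have "arcs ?C = {(x, y) \<in> arcs Q. x \<in> verts ?C \<and> y \<in> verts ?C}"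
      using full by (auto simp only: full_subquiver_def)
    moreover have "v \<in> verts ?C" "w \<in> verts ?C"
      using vw' equiv_class_self[OF eqR] by auto
    ultimately show False
      using vw by auto
  qed
  then have "arcs ?K \<subseteq> verts ?K \<times> verts ?K - Id"
    using in_verts by (auto simp: contraction_def intro!: quotientI)
  \<comment> \<open>With loops excluded, a cycle of the relation yields a list long enough for
    \<open>directed_cycle\<close>.\<close>
  then have "acyclic (arcs ?K)"
    using acyc directed_cycle_if_not_acyclic unfolding acyclic_quiver_def by blast
  moreover have "finite (arcs ?K)"
  proof (rule finite_subset)
    show "arcs ?K \<subseteq> (\<lambda>(v, w). (?c `` {v}, ?c `` {w})) ` (verts Q \<times> verts Q)"
      using in_verts by (auto simp: contraction_def)
    show "finite ((\<lambda>(v, w). (?c `` {v}, ?c `` {w})) ` (verts Q \<times> verts Q))"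
      using assms(1) by (simp add: is_quiver_def)
  qed
  ultimately obtain f :: "'a set \<Rightarrow> nat" where f: "\<forall>(X, Y) \<in> arcs ?K. f X < f Y"
    using finite_acyclic_strict_mono by blast
  have "potential Q R (\<lambda>v. real (f (?c `` {v})))"
    unfolding potential_def
  proof (intro conjI ballI; clarify)
    fix v w assume "(v, w) \<in> arcs R"
    moreover from this have "v \<in> verts R"
      using R by (auto simp: is_quiver_def)
    ultimately have "(v, w) \<in> ?c"
      by (auto simp: contraction_rel_def joined_eq_rtrancl[OF R])
    then show "real (f (?c `` {v})) = real (f (?c `` {w}))"
      using equiv_class_eq[OF eqc] by simp
  next
    fix v w assume "(v, w) \<in> arcs Q" "(v, w) \<notin> arcs R"
    then have "(?c `` {v}, ?c `` {w}) \<in> arcs ?K"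
      by (auto simp: contraction_def)
    then show "real (f (?c `` {v})) < real (f (?c `` {w}))"
      using f by auto
  qed
  then show ?thesis by blast
qed

subsection \<open>Potentials and faces\<close>

lemma inner_edge_vector: "a \<bullet> edge_vector (v, w) = a $ v - a $ w"
  by (simp add: edge_vector_def inner_diff_right inner_axis)

lemma edge_vector_in_DE: "e \<in> arcs Q \<Longrightarrow> edge_vector e \<in> DE Q"
  unfolding DE_def by (intro hull_inc imageI)

text \<open>The functional \<open>x\<^sub>v - x\<^sub>w\<close> is at most \<open>1\<close> on all edge vectors except that of \<open>(v, w)\<close>.\<close>

lemma edge_vector_in_DE_iff:
  assumes "is_quiver R" "v \<noteq> w"
  shows "edge_vector (v, w) \<in> DE R \<longleftrightarrow> (v, w) \<in> arcs R"
proof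
  assume in_DE: "edge_vector (v, w) \<in> DE R"
  show "(v, w) \<in> arcs R"
  proof (rule ccontr)
    assume notin: "(v, w) \<notin> arcs R"
    let ?a = "edge_vector (v, w)"
    \<comment> \<open>The entries of \<open>?a\<close> are 1 at \<open>v\<close>, -1 at
      \<open>w\<close> and 0 elsewhere, so the value 2 would force \<open>x = v\<close> and
      \<open>y = w\<close>.\<close>
    have "?a \<bullet> edge_vector (x, y) \<le> 1" if "(x, y) \<in> arcs R" for x y
    proof -
      have "x \<noteq> y" "(x, y) \<noteq> (v, w)"
        using that notin assms(1) by (auto simp: is_quiver_def)
      then show ?thesis
        using assms(2) by (auto simp: inner_edge_vector) (auto simp: edge_vector_def axis_def)
    qed
    then have "DE R \<subseteq> {x. ?a \<bullet> x \<le> 1}"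
      unfolding DE_def by (intro hull_minimal convex_halfspace_le) auto
    then have "?a \<bullet> ?a \<le> 1"
      using in_DE by blast
    moreover have "?a \<bullet> ?a = 2"
      using assms(2) unfolding inner_edge_vector by (simp add: edge_vector_def axis_def)
    ultimately show False by simp
  qed
qed (rule edge_vector_in_DE)

lemma potential_imp_face:
  fixes Q R :: "'v::finite quiver"
  assumes "potential Q R \<phi>" "arcs R \<subseteq> arcs Q"
  shows "DE R face_of DE Q"
proof -
  define a :: "real ^ 'v" where "a = (\<chi> v. \<phi> v)"
  define H where "H = {x. a \<bullet> x = 0}"
  \<comment> \<open>An edge vector is tail minus head, so an increase of \<phi> along the arc
    becomes a negative value.\<close>
  have le: "a \<bullet> edge_vector e \<le> 0" and eq: "a \<bullet> edge_vector e = 0 \<longleftrightarrow> e \<in> arcs R"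
    if "e \<in> arcs Q" for e
  proof -
    obtain v w where "e = (v, w)" by fastforce
    then show "a \<bullet> edge_vector e \<le> 0" "a \<bullet> edge_vector e = 0 \<longleftrightarrow> e \<in> arcs R"
      using that potential_eq[OF assms(1), of v w] potential_less[OF assms(1), of v w]
      by (cases "e \<in> arcs R"; simp add: a_def inner_edge_vector)+
  qed
  have "DE Q \<subseteq> {x. a \<bullet> x \<le> 0}"
    unfolding DE_def by (intro hull_minimal convex_halfspace_le) (use le in auto)
  then have face: "DE Q \<inter> H face_of DE Q"
    unfolding H_def by (intro face_of_Int_supporting_hyperplane_le) (auto simp: DE_def)
  \<comment> \<open>A face of the hull of a finite set is the hull of some of its points; those
    lying on \<open>H\<close> come from arcs of \<open>R\<close>.\<close>
  then obtain S where S: "S \<subseteq> edge_vector ` arcs Q" "DE Q \<inter> H = convex hull S"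
    unfolding DE_def using face_of_convex_hull_subset finite_imp_compact
    by (metis finite finite_imageI)
  have "S \<subseteq> H"
    using S(2) hull_subset[of S convex] by blast
  then have "S \<subseteq> edge_vector ` arcs R"
    using S(1) eq unfolding H_def by blast
  then have "DE Q \<inter> H \<subseteq> DE R"
    unfolding S(2) unfolding DE_def by (rule hull_mono)
  moreover have "DE R \<subseteq> DE Q"
    unfolding DE_def by (intro hull_mono image_mono assms(2))
  moreover have "DE R \<subseteq> H"
    unfolding DE_def H_def by (intro hull_minimal convex_hyperplane) (use eq assms(2) in auto)
  ultimately have "DE Q \<inter> H = DE R" by blast
  then show ?thesis using face by simp
qed

lemma face_imp_potential:
  fixes Q R :: "'v::finite quiver"
  assumes "is_quiver Q" "is_rank_function Q \<rho>" "subquiver R Q" "DE R face_of DE Q"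
  shows "\<exists>\<phi>. potential Q R \<phi>"
proof -
  have R: "is_quiver R" and RQ: "arcs R \<subseteq> arcs Q"
    using assms(3) by (auto simp: subquiver_def)
  have "polyhedron (DE Q)"
    unfolding DE_def by (intro polytope_imp_polyhedron polytope_convex_hull) simp
  then have "DE R exposed_face_of DE Q"
    using assms(4) by (simp add: exposed_face_of_polyhedron)
  \<comment> \<open>Nothing excludes \<open>a = 0\<close>; with \<open>b > 0\<close> it exposes the
    empty face, which occurs when \<open>R\<close> has no arcs.\<close>
  then obtain a b where ab: "DE Q \<subseteq> {x. a \<bullet> x \<le> b}" "DE R = DE Q \<inter> {x. a \<bullet> x = b}"
    by (auto simp: exposed_face_of_def)
  \<comment> \<open>Equality detects arcs of \<open>R\<close> exactly, because the edge vector of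
    any other arc lies outside \<open>DE R\<close>.\<close>
  have le: "a $ v - a $ w \<le> b" and eq: "a $ v - a $ w = b \<longleftrightarrow> (v, w) \<in> arcs R"
    and \<rho>: "\<rho> w = \<rho> v + 1" if vw: "(v, w) \<in> arcs Q" for v w
  proof -
    have "edge_vector (v, w) \<in> DE Q"
      using edge_vector_in_DE[OF vw] .
    then show "a $ v - a $ w \<le> b" "a $ v - a $ w = b \<longleftrightarrow> (v, w) \<in> arcs R"
      using ab edge_vector_in_DE_iff[OF R, of v w] vw assms(1)
      by (auto simp: is_quiver_def inner_edge_vector[symmetric])
    show "\<rho> w = \<rho> v + 1"
      using assms(2) vw by (auto simp: is_rank_function_def)
  qed
  \<comment> \<open>Along an arc \<open>a\<close> drops by at most \<open>b\<close>, with equality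
    exactly on \<open>R\<close>, while \<open>b * \<rho>\<close> changes by exactly
    \<open>b\<close>.\<close>
  have "potential Q R (\<lambda>v. a $ v + b * \<rho> v)"
    unfolding potential_def
  proof (intro conjI ballI; clarify)
    fix v w assume "(v, w) \<in> arcs R"
    then show "a $ v + b * \<rho> v = a $ w + b * \<rho> w"
      using eq[of v w] \<rho>[of v w] RQ by (auto simp: algebra_simps)
  next
    fix v w assume "(v, w) \<in> arcs Q" "(v, w) \<notin> arcs R"
    then show "a $ v + b * \<rho> v < a $ w + b * \<rho> w"
      using le[of v w] eq[of v w] \<rho>[of v w] by (auto simp: algebra_simps)
  qed
  then show ?thesis by blast
qed

theorem theorem1p3:
  fixes Q R :: "'v::finite quiver"
  assumes "is_quiver Q"
    and "\<exists>\<rho>. is_rank_function Q \<rho>"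
    and "proper_subquiver R Q"
  shows "DE R face_of DE Q \<longleftrightarrow>
    (\<forall>C \<in> connected_components R. full_subquiver C Q) \<and> acyclic_quiver (contraction Q R)"
proof -
  have sub: "subquiver R Q" "arcs R \<subseteq> arcs Q"
    using assms(3) by (auto simp: proper_subquiver_def)
  have "DE R face_of DE Q \<longleftrightarrow> (\<exists>\<phi>. potential Q R \<phi>)"
    using face_imp_potential potential_imp_face assms(1,2) sub by blast
  also have "\<dots> \<longleftrightarrow>
      (\<forall>C \<in> connected_components R. full_subquiver C Q) \<and> acyclic_quiver (contraction Q R)"
    using exists_potential potential_imp_full_components potential_imp_acyclic_contraction
      assms(1) sub(1) by blast
  finally show ?thesis .
qed

end
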